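(* Let $(\mathfrak a,[\cdot,\cdot]_{\mathfrak a},\omega_{\mathfrak a})$ be a symplectic Lie algebra, $a_0,a_1,b_0,b_1,b_2,z\in\mathfrak a$, $D_0,D_1\in\mathfrak{gl}(\mathfrak a)$ and $\varepsilon_0,\dots,\varepsilon_5\in\mathbb R$. Endow $\mathfrak g=\mathbb R d_0\oplus\mathbb R d_1\oplus\mathfrak a\oplus\mathbb R e_0\oplus\mathbb R e_1$ with the skew-symmetric bracket given, for $x,y\in\mathfrak a$ (unspecified brackets being zero or given by skew-symmetry), by $[d_0,e_0]=\varepsilon_0e_0+\varepsilon_1e_1$, $[d_0,e_1]=-\varepsilon_1e_0+\varepsilon_0e_1$, $[d_1,e_0]=\varepsilon_2e_0+\varepsilon_3e_1$, $[d_1,e_1]=-\varepsilon_3e_0+\varepsilon_2e_1$, $[d_0,d_1]=(\varepsilon_2-\varepsilon_1)d_0-(\varepsilon_0+\varepsilon_3)d_1+z+\varepsilon_4e_0+\varepsilon_5e_1$, $[d_0,x]=\omega_{\mathfrak a}(a_0,x)d_0+\omega_{\mathfrak a}(a_1,x)d_1+D_0(x)+\omega_{\mathfrak a}(b_0,x)e_0+\omega_{\mathfrak a}(b_1,x)e_1$, $[d_1,x]=-\omega_{\mathfrak a}(a_1,x)d_0+\omega_{\mathfrak a}(a_0,x)d_1+D_1(x)+\omega_{\mathfrak a}(b_1+z,x)e_0+\omega_{\mathfrak a}(b_2,x)e_1$, $[e_0,x]=-\omega_{\mathfrak a}(a_0,x)e_0+\omega_{\mathfrak a}(a_1,x)e_1$,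 $[e_1,x]=-\omega_{\mathfrak a}(a_1,x)e_0-\omega_{\mathfrak a}(a_0,x)e_1$, $[x,y]=[x,y]_{\mathfrak a}+\varphi_0(x,y)e_0+\varphi_1(x,y)e_1$, where $\varphi_k(x,y):=\omega_{\mathfrak a}(D_k(x),y)+\omega_{\mathfrak a}(x,D_k(y))$, and with the form $\omega=\omega_{\mathfrak a}+d_0^*\wedge e_0^*+d_1^*\wedge e_1^*$. Write $f_k=i_{a_k}\omega_{\mathfrak a}$ ($k=0,1$), $\ell_k=i_{b_k}\omega_{\mathfrak a}$ ($k=0,1,2$), $\zeta=i_z\omega_{\mathfrak a}$. Then $(\mathfrak g,[\cdot,\cdot],\omega)$ is a symplectic Lie algebra if and only if: 1. $a_0,a_1\in[\mathfrak a,\mathfrak a]^\perp$ and $D_0^\divideontimes(a_0)=-\varepsilon_0a_0-\varepsilon_2a_1$, $D_0^\divideontimes(a_1)=\varepsilon_1a_0+\varepsilon_3a_1$, $D_1^\divideontimes(a_0)=-\varepsilon_2a_0+\varepsilon_0a_1$, $D_1^\divideontimes(a_1)=\varepsilon_3a_0-\varepsilon_1a_1$; 2. $\varepsilon_0\varepsilon_1+\varepsilon_2\varepsilon_3=\omega_{\mathfrak a}(a_0,z)$ and $\varepsilon_1(\varepsilon_2-\varepsilon_1)-\varepsilon_3(\varepsilon_0+\varepsilon_3)=\omega_{\mathfrak a}(a_1,z)$; 3. $\widetilde\delta D_0=[\![f_1,D_1]\!]$ and $\widetilde\delta D_1=-[\![f_1,D_0]\!]$, where $\widetilde\delta$ is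 the Chevalley–Eilenberg differential of the representation $x\mapsto\mathrm{ad}^{\mathfrak a}_x+f_0(x)\mathrm{Id}_{\mathfrak a}$ of $\mathfrak a$ on $\mathfrak a$; 4. $\delta_{f_0}\varphi_0=\varphi_1\wedge f_1$ and $\delta_{f_0}\varphi_1=-\varphi_0\wedge f_1$, where $\delta_{f_0}$ is the Chevalley–Eilenberg differential of the representation $x\mapsto f_0(x)\mathrm{Id}_{\mathbb R}$ of $\mathfrak a$ on $\mathbb R$; 5. the following hold: $i_{D_0^\divideontimes(b_1+z)}\omega_{\mathfrak a}-i_{D_1^\divideontimes(b_0)}\omega_{\mathfrak a}+i_z\varphi_0=(\varepsilon_1-2\varepsilon_2)\ell_0+(2\varepsilon_0+\varepsilon_3)(\ell_1+\zeta)-\varepsilon_1\ell_2+\varepsilon_3\ell_1+3\varepsilon_4f_0+\varepsilon_5f_1$, $i_{D_0^\divideontimes(b_2)}\omega_{\mathfrak a}-i_{D_1^\divideontimes(b_1)}\omega_{\mathfrak a}+i_z\varphi_1=(\varepsilon_1-2\varepsilon_2)\ell_1+(2\varepsilon_0+\varepsilon_3)\ell_2+\varepsilon_1(\ell_1+\zeta)-\varepsilon_3\ell_0-\varepsilon_4f_1+3\varepsilon_5f_0$, $D_0\circ D_1-D_1\circ D_0+2\,z\cdot f_0=\mathrm{ad}^{\mathfrak a}_z+(\varepsilon_2-\varepsilon_1)D_0-(\varepsilon_0+\varepsilon_3)D_1$, where $(z\cdot f_0)(x)=f_0(x)z$; 6. with $\varphi^k_{D_{k'}}(x,y):=\varphi_k(D_{k'}(x),y)+\varphi_k(x,D_{k'}(y))$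 for $k,k'\in\{0,1\}$, $\varphi^0_{D_0}-\varepsilon_0\varphi_0+\varepsilon_1\varphi_1=-\delta\ell_0+2\,\ell_0\wedge f_0+(2\ell_1+\zeta)\wedge f_1$, $\varphi^1_{D_0}-\varepsilon_0\varphi_1-\varepsilon_1\varphi_0=-\delta\ell_1+2\,\ell_1\wedge f_0+(\ell_2-\ell_0)\wedge f_1$, $\varphi^0_{D_1}-\varepsilon_2\varphi_0+\varepsilon_3\varphi_1=-\delta(\ell_1+\zeta)+2(\ell_1+\zeta)\wedge f_0+(\ell_2-\ell_0)\wedge f_1$, $\varphi^1_{D_1}-\varepsilon_2\varphi_1-\varepsilon_3\varphi_0=-\delta\ell_2+2\,\ell_2\wedge f_0+(\ell_2-2\ell_1-\zeta)\wedge f_1$.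
   Context: All Lie algebras are real and finite-dimensional. A symplectic Lie algebra $(\mathfrak g,[\cdot,\cdot],\omega)$ is a Lie algebra with a nondegenerate skew-symmetric bilinear form $\omega$ satisfying $\omega([x,y],z)+\omega([y,z],x)+\omega([z,x],y)=0$ for all $x,y,z$. $\perp$ denotes the orthogonal with respect to the symplectic form, $F^\divideontimes$ the adjoint of an endomorphism $F$ ($\omega_{\mathfrak a}(F^\divideontimes(x),y)=\omega_{\mathfrak a}(x,F(y))$), $(i_u\theta)(x)=\theta(u,x)$, and $\mathrm{ad}^{\mathfrak a}$ is the adjoint representation of $\mathfrak a$. For linear forms $\alpha,\beta$, a skew form $\varphi$ and an endomorphism $F$: $(\alpha\wedge\beta)(x,y)=\alpha(x)\beta(y)-\alpha(y)\beta(x)$, $(\varphi\wedge\alpha)(x,y,w)=\varphi(x,y)\alpha(w)+\varphi(w,x)\alpha(y)+\varphi(y,w)\alpha(x)$, $[\![\alpha,F]\!](x,y)=\alpha(x)F(y)-\alpha(y)F(x)$. For a representation $L$ of $\mathfrak a$ on $V$ (the maps in items 3 and 4 are representations once $a_0\in[\mathfrak a,\mathfrak a]^\perp$), the Chevalley–Eilenberg differential is $(\delta_L\theta)(x,y)=L(x)\theta(y)-L(y)\theta(x)-\theta([x,y]_{\mathfrak a})$ on $1$-cochains and $(\delta_L\theta)(x,y,w)=\sum_{\circlearrowright(x,y,w)}\big(L(x)\theta(y,w)+\theta(x,[y,w]_{\mathfrak a})\big)$ on $2$-cochains (cyclic sum). $\delta$ is the one for the trivial representation on $\mathbb R$; in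 particular $(\delta\ell)(x,y)=-\ell([x,y]_{\mathfrak a})$.
   Formalization: The printed equivalence fails; corrected here: item 3 is δ̃D_0=-[[f_1,D_1]], δ̃D_1=[[f_1,D_0]]; item 4 is δ_{f_0}φ_0=-φ_1∧f_1, δ_{f_0}φ_1=φ_0∧f_1; the last term of the last equation of item 6 is (-2ℓ_1-ζ)∧f_1, without ℓ_2. *)

theory Defs
  imports "HOL-Analysis.Analysis"
begin

text \<open>The underlying space is a whole type of class \<^class>\<open>real_vector\<close>, so finite dimension has
  to be required. The class \<open>euclidean_space\<close> would exclude the zero Lie algebra.\<close>

definition lie_algebra :: "('a::real_vector \<Rightarrow> 'a \<Rightarrow> 'a) \<Rightarrow> bool" where
  "lie_algebra br \<longleftrightarrow>
     (\<exists>B::'a set. finite B \<and> span B = UNIV) \<and>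
     bilinear br \<and> (\<forall>x. br x x = 0) \<and>
     (\<forall>x y w. br (br x y) w + br (br y w) x + br (br w x) y = 0)"

definition symplectic_lie_algebra ::
  "('a::real_vector \<Rightarrow> 'a \<Rightarrow> 'a) \<Rightarrow> ('a \<Rightarrow> 'a \<Rightarrow> real) \<Rightarrow> bool" where
  "symplectic_lie_algebra br \<omega> \<longleftrightarrow>
     lie_algebra br \<and> bilinear \<omega> \<and> (\<forall>x y. \<omega> x y = - \<omega> y x) \<and>
     (\<forall>x. (\<forall>y. \<omega> x y = 0) \<longrightarrow> x = 0) \<and>
     (\<forall>x y w. \<omega> (br x y) w + \<omega> (br y w) x + \<omega> (br w x) y = 0)"

definition derived_algebra :: "('a::real_vector \<Rightarrow> 'a \<Rightarrow> 'a) \<Rightarrow> 'a set" where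
  "derived_algebra br = span {br x y | x y. True}"

definition symp_orth :: "('a::real_vector \<Rightarrow> 'a \<Rightarrow> real) \<Rightarrow> 'a set \<Rightarrow> 'a set" where
  "symp_orth \<omega> S = {u. \<forall>v\<in>S. \<omega> u v = 0}"

definition symp_adjoint ::
  "('a::real_vector \<Rightarrow> 'a \<Rightarrow> real) \<Rightarrow> ('a \<Rightarrow> 'a) \<Rightarrow> 'a \<Rightarrow> 'a" where
  "symp_adjoint \<omega> F = (THE G. linear G \<and> (\<forall>x y. \<omega> (G x) y = \<omega> x (F y)))"

definition interior_prod :: "'a \<Rightarrow> ('a \<Rightarrow> 'a \<Rightarrow> real) \<Rightarrow> 'a \<Rightarrow> real" where
  "interior_prod u \<theta> = (\<lambda>x. \<theta> u x)"

definition wedge11 :: "('a \<Rightarrow> real) \<Rightarrow> ('a \<Rightarrow> real) \<Rightarrow> 'a \<Rightarrow> 'a \<Rightarrow> real" where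
  "wedge11 \<alpha> \<beta> x y = \<alpha> x * \<beta> y - \<alpha> y * \<beta> x"

definition wedge21 ::
  "('a \<Rightarrow> 'a \<Rightarrow> real) \<Rightarrow> ('a \<Rightarrow> real) \<Rightarrow> 'a \<Rightarrow> 'a \<Rightarrow> 'a \<Rightarrow> real" where
  "wedge21 \<phi> \<alpha> x y w = \<phi> x y * \<alpha> w + \<phi> w x * \<alpha> y + \<phi> y w * \<alpha> x"

text \<open>The vector-valued form \<open>\<lbrakk>\<alpha>, F\<rbrakk>\<close>.\<close>

definition form_endo ::
  "('a::real_vector \<Rightarrow> real) \<Rightarrow> ('a \<Rightarrow> 'a) \<Rightarrow> 'a \<Rightarrow> 'a \<Rightarrow> 'a" where
  "form_endo \<alpha> F x y = \<alpha> x *\<^sub>R F y - \<alpha> y *\<^sub>R F x"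

text \<open>\<open>act_on_form \<omega> D\<^sub>k\<close> is \<open>\<phi>\<^sub>k\<close>, and \<open>act_on_form \<phi>\<^sub>k D\<^sub>j\<close> is the form written
  \<open>\<phi>\<close> with upper index \<open>k\<close> and lower index \<open>D\<^sub>j\<close>.\<close>

definition act_on_form ::
  "('a \<Rightarrow> 'a \<Rightarrow> real) \<Rightarrow> ('a \<Rightarrow> 'a) \<Rightarrow> 'a \<Rightarrow> 'a \<Rightarrow> real" where
  "act_on_form \<theta> F x y = \<theta> (F x) y + \<theta> x (F y)"

text \<open>Chevalley--Eilenberg differentials on 1- and 2-cochains for a representation \<open>L\<close>.\<close>

definition ce_diff1 ::
  "('a \<Rightarrow> 'a \<Rightarrow> 'a) \<Rightarrow> ('a \<Rightarrow> 'v \<Rightarrow> 'v) \<Rightarrow> ('a \<Rightarrow> 'v::real_vector) \<Rightarrow> 'a \<Rightarrow> 'a \<Rightarrow> 'v" where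
  "ce_diff1 br L \<theta> x y = L x (\<theta> y) - L y (\<theta> x) - \<theta> (br x y)"

definition ce_diff2 ::
  "('a \<Rightarrow> 'a \<Rightarrow> 'a) \<Rightarrow> ('a \<Rightarrow> 'v \<Rightarrow> 'v) \<Rightarrow> ('a \<Rightarrow> 'a \<Rightarrow> 'v::real_vector)
     \<Rightarrow> 'a \<Rightarrow> 'a \<Rightarrow> 'a \<Rightarrow> 'v" where
  "ce_diff2 br L \<theta> x y w =
     (L x (\<theta> y w) + \<theta> x (br y w)) +
     (L y (\<theta> w x) + \<theta> y (br w x)) +
     (L w (\<theta> x y) + \<theta> w (br x y))"

definition trivial_diff :: "('a \<Rightarrow> 'a \<Rightarrow> 'a) \<Rightarrow> ('a \<Rightarrow> real) \<Rightarrow> 'a \<Rightarrow> 'a \<Rightarrow> real" where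
  "trivial_diff br = ce_diff1 br (\<lambda>x t. 0)"

text \<open>An element \<open>p d\<^sub>0 + q d\<^sub>1 + x + r e\<^sub>0 + s e\<^sub>1\<close> of the extension is the tuple
  \<open>(p, q, x, r, s)\<close>.\<close>

type_synonym 'a ext = "real \<times> real \<times> 'a \<times> real \<times> real"

definition ext_d0 :: "'a::real_vector ext" where "ext_d0 = (1, 0, 0, 0, 0)"
definition ext_d1 :: "'a::real_vector ext" where "ext_d1 = (0, 1, 0, 0, 0)"
definition ext_in :: "'a \<Rightarrow> 'a::real_vector ext" where "ext_in x = (0, 0, x, 0, 0)"
definition ext_e0 :: "'a::real_vector ext" where "ext_e0 = (0, 0, 0, 1, 0)"
definition ext_e1 :: "'a::real_vector ext" where "ext_e1 = (0, 0, 0, 0, 1)"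

definition dual_d0 :: "'a ext \<Rightarrow> real" where "dual_d0 = (\<lambda>(p, q, x, r, s). p)"
definition dual_d1 :: "'a ext \<Rightarrow> real" where "dual_d1 = (\<lambda>(p, q, x, r, s). q)"
definition ext_proj :: "'a ext \<Rightarrow> 'a" where "ext_proj = (\<lambda>(p, q, x, r, s). x)"
definition dual_e0 :: "'a ext \<Rightarrow> real" where "dual_e0 = (\<lambda>(p, q, x, r, s). r)"
definition dual_e1 :: "'a ext \<Rightarrow> real" where "dual_e1 = (\<lambda>(p, q, x, r, s). s)"

definition ext_form :: "('a \<Rightarrow> 'a \<Rightarrow> real) \<Rightarrow> 'a ext \<Rightarrow> 'a ext \<Rightarrow> real" where
  "ext_form \<omega> u v =
     \<omega> (ext_proj u) (ext_proj v) + wedge11 dual_d0 dual_e0 u v + wedge11 dual_d1 dual_e1 u v"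

text \<open>The skew-symmetric bilinear bracket with the prescribed values. Every pair of distinct
  summands of the extension occurs in one line, with the prescribed bracket multiplied by the
  corresponding minor (or, against \<open>\<aa>\<close>, skew-symmetrized in the \<open>\<aa>\<close>-argument, where \<open>\<aa>\<close>
  is the given algebra); the last line is the bracket of \<open>\<aa>\<close> itself.\<close>

definition ext_bracket ::
  "('a::real_vector \<Rightarrow> 'a \<Rightarrow> 'a) \<Rightarrow> ('a \<Rightarrow> 'a \<Rightarrow> real) \<Rightarrow> 'a \<Rightarrow> 'a \<Rightarrow> 'a \<Rightarrow> 'a \<Rightarrow> 'a \<Rightarrow> 'a
     \<Rightarrow> ('a \<Rightarrow> 'a) \<Rightarrow> ('a \<Rightarrow> 'a) \<Rightarrow> real \<Rightarrow> real \<Rightarrow> real \<Rightarrow> real \<Rightarrow> real \<Rightarrow> real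
     \<Rightarrow> 'a ext \<Rightarrow> 'a ext \<Rightarrow> 'a ext" where
  "ext_bracket br \<omega> a0 a1 b0 b1 b2 z D0 D1 \<epsilon>0 \<epsilon>1 \<epsilon>2 \<epsilon>3 \<epsilon>4 \<epsilon>5 u v =
    (let x = ext_proj u; y = ext_proj v;
         d0x = (\<lambda>x. \<omega> a0 x *\<^sub>R ext_d0 + \<omega> a1 x *\<^sub>R ext_d1 + ext_in (D0 x)
                    + \<omega> b0 x *\<^sub>R ext_e0 + \<omega> b1 x *\<^sub>R ext_e1);
         d1x = (\<lambda>x. - \<omega> a1 x *\<^sub>R ext_d0 + \<omega> a0 x *\<^sub>R ext_d1 + ext_in (D1 x)
                    + \<omega> (b1 + z) x *\<^sub>R ext_e0 + \<omega> b2 x *\<^sub>R ext_e1);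
         e0x = (\<lambda>x. - \<omega> a0 x *\<^sub>R ext_e0 + \<omega> a1 x *\<^sub>R ext_e1);
         e1x = (\<lambda>x. - \<omega> a1 x *\<^sub>R ext_e0 - \<omega> a0 x *\<^sub>R ext_e1)
     in wedge11 dual_d0 dual_e0 u v *\<^sub>R (\<epsilon>0 *\<^sub>R ext_e0 + \<epsilon>1 *\<^sub>R ext_e1)
      + wedge11 dual_d0 dual_e1 u v *\<^sub>R (- \<epsilon>1 *\<^sub>R ext_e0 + \<epsilon>0 *\<^sub>R ext_e1)
      + wedge11 dual_d1 dual_e0 u v *\<^sub>R (\<epsilon>2 *\<^sub>R ext_e0 + \<epsilon>3 *\<^sub>R ext_e1)
      + wedge11 dual_d1 dual_e1 u v *\<^sub>R (- \<epsilon>3 *\<^sub>R ext_e0 + \<epsilon>2 *\<^sub>R ext_e1)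
      + wedge11 dual_d0 dual_d1 u v *\<^sub>R
          ((\<epsilon>2 - \<epsilon>1) *\<^sub>R ext_d0 - (\<epsilon>0 + \<epsilon>3) *\<^sub>R ext_d1 + ext_in z
           + \<epsilon>4 *\<^sub>R ext_e0 + \<epsilon>5 *\<^sub>R ext_e1)
      + (dual_d0 u *\<^sub>R d0x y - dual_d0 v *\<^sub>R d0x x)
      + (dual_d1 u *\<^sub>R d1x y - dual_d1 v *\<^sub>R d1x x)
      + (dual_e0 u *\<^sub>R e0x y - dual_e0 v *\<^sub>R e0x x)
      + (dual_e1 u *\<^sub>R e1x y - dual_e1 v *\<^sub>R e1x x)
      + (ext_in (br x y) + act_on_form \<omega> D0 x y *\<^sub>R ext_e0
         + act_on_form \<omega> D1 x y *\<^sub>R ext_e1))"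

lemmas ext_basis_defs = ext_d0_def ext_d1_def ext_in_def ext_e0_def ext_e1_def
lemmas ext_coord_defs = dual_d0_def dual_d1_def ext_proj_def dual_e0_def dual_e1_def

lemma ext_bracket_skew:
  assumes "bilinear br" "\<And>x. br x x = 0" "\<And>x y. \<omega> x y = - \<omega> y x"
  shows "ext_bracket br \<omega> a0 a1 b0 b1 b2 z D0 D1 \<epsilon>0 \<epsilon>1 \<epsilon>2 \<epsilon>3 \<epsilon>4 \<epsilon>5 u v
       = - ext_bracket br \<omega> a0 a1 b0 b1 b2 z D0 D1 \<epsilon>0 \<epsilon>1 \<epsilon>2 \<epsilon>3 \<epsilon>4 \<epsilon>5 v u"
proof -
  have br: "br x y = - br y x" for x y
  proof -
    have "br (x + y) (x + y) = br x x + br x y + (br y x + br y y)"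
      by (simp add: bilinear_ladd[OF assms(1)] bilinear_radd[OF assms(1)] algebra_simps)
    then show ?thesis using assms(2) by (simp add: eq_neg_iff_add_eq_0)
  qed
  have act: "act_on_form \<omega> D x y = - act_on_form \<omega> D y x" for D x y
    using assms(3)[of "D x" y] assms(3)[of x "D y"] by (simp add: act_on_form_def)
  show ?thesis
    unfolding ext_bracket_def Let_def
    by (subst br[of "ext_proj u"], subst act[of D0 "ext_proj u"], subst act[of D1 "ext_proj u"])
       (simp add: ext_basis_defs wedge11_def prod_eq_iff algebra_simps)
qed

lemma ext_bracket_values:
  fixes br :: "'a::real_vector \<Rightarrow> 'a \<Rightarrow> 'a" and a0 a1 b0 b1 b2 z :: 'a
    and \<epsilon>0 \<epsilon>1 \<epsilon>2 \<epsilon>3 \<epsilon>4 \<epsilon>5 :: real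
  assumes "bilinear br" "bilinear \<omega>" "linear D0" "linear D1"
  defines "B \<equiv> ext_bracket br \<omega> a0 a1 b0 b1 b2 z D0 D1 \<epsilon>0 \<epsilon>1 \<epsilon>2 \<epsilon>3 \<epsilon>4 \<epsilon>5"
  shows "bilinear B"
    and "B ext_d0 ext_e0 = \<epsilon>0 *\<^sub>R ext_e0 + \<epsilon>1 *\<^sub>R ext_e1"
    and "B ext_d0 ext_e1 = - \<epsilon>1 *\<^sub>R ext_e0 + \<epsilon>0 *\<^sub>R ext_e1"
    and "B ext_d1 ext_e0 = \<epsilon>2 *\<^sub>R ext_e0 + \<epsilon>3 *\<^sub>R ext_e1"
    and "B ext_d1 ext_e1 = - \<epsilon>3 *\<^sub>R ext_e0 + \<epsilon>2 *\<^sub>R ext_e1"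
    and "B ext_e0 ext_e1 = 0"
    and "B ext_d0 ext_d1 = (\<epsilon>2 - \<epsilon>1) *\<^sub>R ext_d0 - (\<epsilon>0 + \<epsilon>3) *\<^sub>R ext_d1 + ext_in z
           + \<epsilon>4 *\<^sub>R ext_e0 + \<epsilon>5 *\<^sub>R ext_e1"
    and "B ext_d0 (ext_in x) = \<omega> a0 x *\<^sub>R ext_d0 + \<omega> a1 x *\<^sub>R ext_d1 + ext_in (D0 x)
           + \<omega> b0 x *\<^sub>R ext_e0 + \<omega> b1 x *\<^sub>R ext_e1"
    and "B ext_d1 (ext_in x) = - \<omega> a1 x *\<^sub>R ext_d0 + \<omega> a0 x *\<^sub>R ext_d1 + ext_in (D1 x)
           + \<omega> (b1 + z) x *\<^sub>R ext_e0 + \<omega> b2 x *\<^sub>R ext_e1"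
    and "B ext_e0 (ext_in x) = - \<omega> a0 x *\<^sub>R ext_e0 + \<omega> a1 x *\<^sub>R ext_e1"
    and "B ext_e1 (ext_in x) = - \<omega> a1 x *\<^sub>R ext_e0 - \<omega> a0 x *\<^sub>R ext_e1"
    and "B (ext_in x) (ext_in y) = ext_in (br x y) + act_on_form \<omega> D0 x y *\<^sub>R ext_e0
           + act_on_form \<omega> D1 x y *\<^sub>R ext_e1"
proof -
  note lin = bilinear_lzero[OF assms(1)] bilinear_rzero[OF assms(1)]
    bilinear_lzero[OF assms(2)] bilinear_rzero[OF assms(2)]
    bilinear_ladd[OF assms(1)] bilinear_radd[OF assms(1)]
    bilinear_ladd[OF assms(2)] bilinear_radd[OF assms(2)]
    bilinear_lmul[OF assms(1)] bilinear_rmul[OF assms(1)]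
    bilinear_lmul[OF assms(2)] bilinear_rmul[OF assms(2)]
    linear_0[OF assms(3)] linear_0[OF assms(4)]
    linear_add[OF assms(3)] linear_add[OF assms(4)]
    linear_scale[OF assms(3)] linear_scale[OF assms(4)]
  note defs = B_def ext_bracket_def Let_def ext_basis_defs ext_coord_defs wedge11_def
    act_on_form_def
  show "bilinear B"
    unfolding bilinear_def linear_iff
    by (auto simp: defs lin prod_eq_iff algebra_simps)
qed (simp_all add: B_def ext_bracket_def Let_def ext_basis_defs ext_coord_defs wedge11_def
    act_on_form_def bilinear_lzero[OF assms(1)] bilinear_rzero[OF assms(1)]
    bilinear_lzero[OF assms(2)] bilinear_rzero[OF assms(2)]
    linear_0[OF assms(3)] linear_0[OF assms(4)] prod_eq_iff)

end

theory Submission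
  imports Defs
begin

text \<open>The form \<open>ext_form \<omega>\<close> is skew-symmetric and nondegenerate, and it is closed for every choice
  of the parameters: the components of \<open>ext_bracket\<close> along \<open>d\<^sub>0, d\<^sub>1, e\<^sub>0, e\<^sub>1\<close> are arranged so that the
  terms of the cocycle condition cancel (\<open>form_closed\<close>). So the extension is a symplectic Lie algebra
  exactly if its bracket satisfies the Jacobi identity.

  Both the Jacobi identity and closedness say that a cyclic sum \<open>\<beta> (br u v) w + \<dots>\<close>, with \<open>\<beta>\<close> the
  bracket or the form, vanishes. For a skew-symmetric bracket this sum is an alternating trilinear map,
  hence it vanishes as soon as it vanishes on triples taken from \<open>d\<^sub>0, d\<^sub>1, e\<^sub>0, e\<^sub>1\<close> and the given algebra,
  each up to order (\<open>alternating_ext_zero\<close>). The triples \<open>(d\<^sub>i, e\<^sub>0, e\<^sub>1)\<close> and \<open>(e\<^sub>0, e\<^sub>1, x)\<close> impose nothing,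
  since \<open>d\<^sub>0\<close>, \<open>d\<^sub>1\<close> and \<open>x\<close> act on the plane of \<open>e\<^sub>0, e\<^sub>1\<close>, on which the bracket is zero. With \<open>e\<^sub>0 = 1\<close>
  and \<open>e\<^sub>1 = \<i>\<close> they act as multiplication by complex numbers, which is why \<open>(d\<^sub>k, e\<^sub>0, x)\<close> and
  \<open>(d\<^sub>k, e\<^sub>1, x)\<close> give the same conditions.

  The other triples give the conditions, one coordinate of the extension at a time:
  \<open>(e\<^sub>i, x, y)\<close> gives \<open>a\<^sub>0, a\<^sub>1 \<in> [\<aa>, \<aa>]\<^sup>\<bottom>\<close>; \<open>(d\<^sub>k, e\<^sub>i, x)\<close> gives the values of the adjoints
  in item 1; \<open>(d\<^sub>0, d\<^sub>1, e\<^sub>i)\<close> gives item 2; \<open>(x, y, w)\<close> gives item 4; and \<open>(d\<^sub>k, x, y)\<close> gives item 3 in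
  the coordinate of \<open>\<aa>\<close> and item 6 in the coordinates of \<open>e\<^sub>0, e\<^sub>1\<close>, while its coordinates along \<open>d\<^sub>0, d\<^sub>1\<close>
  vanish once \<open>a\<^sub>0, a\<^sub>1 \<in> [\<aa>, \<aa>]\<^sup>\<bottom>\<close>. Finally \<open>(d\<^sub>0, d\<^sub>1, x)\<close> gives item 5, its coordinates along \<open>d\<^sub>0, d\<^sub>1\<close>
  vanishing once the adjoints have the values in item 1. To read off items 1 and 5, finite dimension
  is used to see that \<open>symp_adjoint\<close> is the adjoint (\<open>symp_adjoint_eq\<close>).\<close>

section \<open>Cyclic sums\<close>

text \<open>For \<open>\<beta> = br\<close> this is the Jacobiator; for a 2-form \<open>\<beta>\<close> it is, up to sign, the differential of \<open>\<beta>\<close>.\<close>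

definition cyclic_sum ::
  "('a \<Rightarrow> 'a \<Rightarrow> 'b::real_vector) \<Rightarrow> ('a::real_vector \<Rightarrow> 'a \<Rightarrow> 'a) \<Rightarrow> 'a \<Rightarrow> 'a \<Rightarrow> 'a \<Rightarrow> 'b" where
  "cyclic_sum \<beta> br u v w = \<beta> (br u v) w + \<beta> (br v w) u + \<beta> (br w u) v"

lemma cyclic_sum_rotate: "cyclic_sum \<beta> br u v w = cyclic_sum \<beta> br v w u"
  by (simp add: cyclic_sum_def)

lemma cyclic_sum_swap:
  assumes "bilinear \<beta>" and "\<And>u v. br u v = - br v u"
  shows "cyclic_sum \<beta> br v u w = - cyclic_sum \<beta> br u v w"
proof -
  have "\<beta> (br v u) w = - \<beta> (br u v) w" "\<beta> (br u w) v = - \<beta> (br w u) v"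
    "\<beta> (br w v) u = - \<beta> (br v w) u"
    by (metis assms bilinear_lneg)+
  then show ?thesis by (simp add: cyclic_sum_def)
qed

lemma cyclic_sum_linear:
  assumes "bilinear \<beta>" "bilinear br"
  shows "linear (\<lambda>u. cyclic_sum \<beta> br u v w)"
  unfolding linear_iff cyclic_sum_def
  by (auto simp: bilinear_ladd[OF assms(1)] bilinear_radd[OF assms(1)] bilinear_ladd[OF assms(2)]
      bilinear_radd[OF assms(2)] bilinear_lmul[OF assms(1)] bilinear_rmul[OF assms(1)]
      bilinear_lmul[OF assms(2)] bilinear_rmul[OF assms(2)] algebra_simps)

section \<open>Alternating trilinear maps on the extension\<close>

lemma ext_decompose:
  "(u::'a::real_vector ext) = dual_d0 u *\<^sub>R ext_d0 + dual_d1 u *\<^sub>R ext_d1 + ext_in (ext_proj u)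
     + dual_e0 u *\<^sub>R ext_e0 + dual_e1 u *\<^sub>R ext_e1"
  by (simp add: ext_coord_defs ext_basis_defs split: prod.splits)

text \<open>A spanning set that contains the whole middle summand, so that no basis of it has to be chosen.\<close>

definition ext_basis :: "'a::real_vector ext set" where
  "ext_basis = {ext_d0, ext_d1, ext_e0, ext_e1} \<union> range ext_in"

lemma linear_ext_zero:
  fixes L :: "'a::real_vector ext \<Rightarrow> 'b::real_vector"
  assumes "linear L" "\<And>b. b \<in> ext_basis \<Longrightarrow> L b = 0"
  shows "L u = 0"
  using assms(2)
  by (subst ext_decompose[of u]) (simp add: ext_basis_def linear_add[OF assms(1)] linear_scale[OF assms(1)])

text \<open>Every vector is a combination of members of \<open>ext_basis\<close>, so by linearity in each argument it
  suffices to test \<open>T\<close> on such vectors. By the symmetries of \<open>T\<close> the arguments may be ordered, and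
  triples with a repeated \<open>d\<^sub>0\<close>, \<open>d\<^sub>1\<close>, \<open>e\<^sub>0\<close> or \<open>e\<^sub>1\<close> drop out.\<close>

lemma alternating_ext_zero:
  fixes T :: "'a::real_vector ext \<Rightarrow> 'a ext \<Rightarrow> 'a ext \<Rightarrow> 'b::real_vector"
  assumes lin: "\<And>v w. linear (\<lambda>u. T u v w)"
    and rot: "\<And>u v w. T u v w = T v w u"
    and swap: "\<And>u v w. T v u w = - T u v w"
    and dde: "T ext_d0 ext_d1 ext_e0 = 0" "T ext_d0 ext_d1 ext_e1 = 0"
    and dee: "T ext_d0 ext_e0 ext_e1 = 0" "T ext_d1 ext_e0 ext_e1 = 0"
    and ddx: "\<And>x. T ext_d0 ext_d1 (ext_in x) = 0"
    and dex: "\<And>x. T ext_d0 ext_e0 (ext_in x) = 0" "\<And>x. T ext_d0 ext_e1 (ext_in x) = 0"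
      "\<And>x. T ext_d1 ext_e0 (ext_in x) = 0" "\<And>x. T ext_d1 ext_e1 (ext_in x) = 0"
    and eex: "\<And>x. T ext_e0 ext_e1 (ext_in x) = 0"
    and dxy: "\<And>x y. T ext_d0 (ext_in x) (ext_in y) = 0" "\<And>x y. T ext_d1 (ext_in x) (ext_in y) = 0"
    and exy: "\<And>x y. T ext_e0 (ext_in x) (ext_in y) = 0" "\<And>x y. T ext_e1 (ext_in x) (ext_in y) = 0"
    and xyw: "\<And>x y w. T (ext_in x) (ext_in y) (ext_in w) = 0"
  shows "T u v w = 0"
proof -
  have rep: "T u u w = 0" for u w
    using swap[of u u w] by (simp add: eq_neg_iff_add_eq_0 flip: scaleR_2)
  have rep': "T u w u = 0" "T w u u = 0" for u w
    using rot[of u w u] rot[of w u u] rep by simp_all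
  note zeros = dde dee ddx dex eex dxy exy xyw
  have perm: "T u w v = 0" "T v u w = 0" "T v w u = 0" "T w u v = 0" "T w v u = 0"
    if "T u v w = 0" for u v w
    using that rot[of u v w] rot[of v w u] rot[of v u w] rot[of u w v] swap[of u v w] by auto
  \<comment> \<open>Every triple from the spanning set, in any order, is an instance of one of these equations.\<close>
  note all = rep rep' zeros zeros[THEN perm(1)] zeros[THEN perm(2)] zeros[THEN perm(3)]
    zeros[THEN perm(4)] zeros[THEN perm(5)]
  have basis: "T a b c = 0" if "a \<in> ext_basis" "b \<in> ext_basis" "c \<in> ext_basis" for a b c
    using that unfolding ext_basis_def by (elim UnE insertE emptyE rangeE; simp only: all)
  have 1: "T u b c = 0" if "b \<in> ext_basis" "c \<in> ext_basis" for u b c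
    by (rule linear_ext_zero[of "\<lambda>u. T u b c", OF lin]) (simp add: basis that)
  have 2: "T v c u = 0" if "c \<in> ext_basis" for u v c
    by (rule linear_ext_zero[of "\<lambda>v. T v c u", OF lin]) (simp only: rot[of _ c u] rot[of c u] 1 that)
  have "T w u v = 0"
    by (rule linear_ext_zero[of "\<lambda>w. T w u v", OF lin]) (simp only: rot[of _ u v] rot[of u v] 2)
  then show ?thesis by (simp only: rot[of w u v])
qed

section \<open>Adjoints with respect to a nondegenerate form\<close>

text \<open>For a basis \<open>B\<close>, the map \<open>u \<mapsto> (\<omega> u b)\<^sub>b\<^sub>\<in>\<^sub>B\<close> is injective because \<open>\<omega>\<close> is nondegenerate. Reading the
  coordinate family as a vector turns it into an endomorphism, and injective endomorphisms of a
  finite-dimensional space are surjective.\<close>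

lemma nondegenerate_represents:
  fixes \<omega> :: "'a::real_vector \<Rightarrow> 'a \<Rightarrow> real"
  assumes "finite S" "span S = (UNIV::'a set)" and bil: "bilinear \<omega>"
    and nondeg: "\<And>u. (\<And>y. \<omega> u y = 0) \<Longrightarrow> u = 0" and g: "linear g"
  shows "\<exists>u. \<forall>y. \<omega> u y = g y"
proof -
  obtain B where B: "B \<subseteq> S" "independent B" "span B = span S"
    using maximal_independent_subset by (metis span_eq span_superset order_trans)
  have fin: "finite B" using B assms(1) finite_subset by blast
  interpret B: finite_dimensional_vector_space scaleR B
    by unfold_locales
       (use B fin assms in \<open>auto simp: dependent_raw_def span_raw_def\<close>)
  let ?T = "\<lambda>u. \<Sum>b\<in>B. \<omega> u b *\<^sub>R b"
  have coeff: "\<forall>b\<in>B. c b = d b" if "(\<Sum>b\<in>B. c b *\<^sub>R b) = (\<Sum>b\<in>B. d b *\<^sub>R b)" for c d :: "'a \<Rightarrow> real"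
  proof -
    have "(\<Sum>b\<in>B. (c b - d b) *\<^sub>R b) = 0"
      using that by (simp add: scaleR_left_diff_distrib sum_subtractf)
    then show ?thesis using independentD[OF B(2) fin subset_refl, of "\<lambda>b. c b - d b"] by auto
  qed
  have ext: "\<forall>y. h y = k y" if "linear h" "linear k" "\<forall>b\<in>B. h b = k b" for h k :: "'a \<Rightarrow> real"
    using linear_eq_on_span[OF that(1,2), of B] that(3) B assms(2) by auto
  have lin: "linear (\<omega> u)" for u using bil by (simp add: bilinear_def)
  have T: "linear ?T"
    unfolding linear_iff
    by (auto simp: bilinear_ladd[OF bil] bilinear_lmul[OF bil] algebra_simps sum.distrib scaleR_sum_right)
  have "inj ?T"
  proof (rule linear_injective_0[OF T, THEN iffD2], intro allI impI)
    fix u assume "?T u = 0"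
    then have "\<forall>b\<in>B. \<omega> u b = 0" using coeff[of "\<omega> u" "\<lambda>_. 0"] by simp
    then show "u = 0" using ext[OF lin, of "\<lambda>_. 0"] nondeg by (simp add: linear_zero)
  qed
  then have "surj ?T" by (rule B.linear_inj_imp_surj[OF T[unfolded linear_def]])
  from surjD[OF this, of "\<Sum>b\<in>B. g b *\<^sub>R b"]
  obtain u where "?T u = (\<Sum>b\<in>B. g b *\<^sub>R b)" by auto
  from ext[OF lin g coeff[OF this]] show ?thesis by blast
qed

lemma symplectic_finite_span:
  "symplectic_lie_algebra (br :: 'a::real_vector \<Rightarrow> 'a \<Rightarrow> 'a) \<omega> \<Longrightarrow> \<exists>S::'a set. finite S \<and> span S = UNIV"
  unfolding symplectic_lie_algebra_def lie_algebra_def by (elim conjE)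

text \<open>The description by which \<open>symp_adjoint\<close> is defined has a unique solution: existence is
  \<open>nondegenerate_represents\<close> applied to each functional \<open>\<omega> u \<circ> F\<close>, uniqueness and linearity follow from
  nondegeneracy.\<close>

lemma symp_adjoint_eq:
  assumes symp: "symplectic_lie_algebra br \<omega>" and F: "linear F"
  shows "\<omega> (symp_adjoint \<omega> F u) y = \<omega> u (F y)"
proof -
  have bil: "bilinear \<omega>" and nd: "\<And>u. (\<And>y. \<omega> u y = 0) \<Longrightarrow> u = 0"
    using symp unfolding symplectic_lie_algebra_def by blast+
  obtain S where S: "finite S" "span S = (UNIV::'a set)"
    using symplectic_finite_span[OF symp] by blast
  have lin: "linear (\<lambda>y. \<omega> u (F y))" for u
    using linear_compose[OF F, of "\<omega> u"] bil by (simp add: bilinear_def o_def)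
  obtain G where G: "\<And>u y. \<omega> (G u) y = \<omega> u (F y)"
    using nondegenerate_represents[OF S bil nd lin] by metis
  have uniq: "u = v" if "\<And>y. \<omega> u y = \<omega> v y" for u v
    using nd[of "u - v"] that by (simp add: bilinear_lsub[OF bil])
  have "linear G"
    unfolding linear_iff
    by (auto intro!: uniq simp: G bilinear_ladd[OF bil] bilinear_lmul[OF bil])
  moreover have "H = G" if "linear H \<and> (\<forall>x y. \<omega> (H x) y = \<omega> x (F y))" for H
    by (rule ext, rule uniq) (simp add: G that)
  ultimately have "symp_adjoint \<omega> F = G"
    unfolding symp_adjoint_def using G by (intro the_equality) blast+
  then show ?thesis by (simp add: G)
qed

section \<open>The bracket and the form of the extension\<close>

locale symplectic_extension =
  fixes br :: "'a::real_vector \<Rightarrow> 'a \<Rightarrow> 'a" and \<omega> :: "'a \<Rightarrow> 'a \<Rightarrow> real"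
    and a0 a1 b0 b1 b2 z :: 'a and D0 D1 :: "'a \<Rightarrow> 'a" and \<epsilon>0 \<epsilon>1 \<epsilon>2 \<epsilon>3 \<epsilon>4 \<epsilon>5 :: real
  assumes symp: "symplectic_lie_algebra br \<omega>" and D: "linear D0" "linear D1"
begin

definition bracket :: "'a ext \<Rightarrow> 'a ext \<Rightarrow> 'a ext" where
  "bracket = ext_bracket br \<omega> a0 a1 b0 b1 b2 z D0 D1 \<epsilon>0 \<epsilon>1 \<epsilon>2 \<epsilon>3 \<epsilon>4 \<epsilon>5"

abbreviation jacobiator :: "'a ext \<Rightarrow> 'a ext \<Rightarrow> 'a ext \<Rightarrow> 'a ext" where
  "jacobiator \<equiv> cyclic_sum bracket bracket"

abbreviation \<phi>0 :: "'a \<Rightarrow> 'a \<Rightarrow> real" where "\<phi>0 \<equiv> act_on_form \<omega> D0"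
abbreviation \<phi>1 :: "'a \<Rightarrow> 'a \<Rightarrow> real" where "\<phi>1 \<equiv> act_on_form \<omega> D1"

lemma br_bil: "bilinear br" and \<omega>_bil: "bilinear \<omega>" and br_self: "br x x = 0"
  and \<omega>_skew: "\<omega> x y = - \<omega> y x"
  and jacobi: "br (br x y) w + br (br y w) x + br (br w x) y = 0"
  and closed: "\<omega> (br x y) w + \<omega> (br y w) x + \<omega> (br w x) y = 0"
  and nondeg: "(\<And>y. \<omega> x y = 0) \<Longrightarrow> x = 0"
  using symp unfolding symplectic_lie_algebra_def lie_algebra_def by blast+

lemma bracket_bil: "bilinear bracket"
  unfolding bracket_def by (rule ext_bracket_values(1)[OF br_bil \<omega>_bil D])

lemma bracket_skew: "bracket u v = - bracket v u"
  unfolding bracket_def by (rule ext_bracket_skew[OF br_bil br_self \<omega>_skew])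

lemma br_skew: "br x y = - br y x"
proof -
  have "br (x + y) (x + y) = br x x + br x y + (br y x + br y y)"
    by (simp only: bilinear_ladd[OF br_bil] bilinear_radd[OF br_bil] ac_simps)
  then have "br x y + br y x = 0" by (simp add: br_self)
  then show ?thesis by (simp add: eq_neg_iff_add_eq_0)
qed

lemma act_on_form_skew: "act_on_form \<omega> F x y = - act_on_form \<omega> F y x"
  using \<omega>_skew[of "F x" y] \<omega>_skew[of x "F y"] by (simp add: act_on_form_def)

lemma act_on_form_zero: "linear F \<Longrightarrow> act_on_form \<omega> F 0 y = 0" "linear F \<Longrightarrow> act_on_form \<omega> F y 0 = 0"
  by (simp_all add: act_on_form_def linear_0 bilinear_lzero[OF \<omega>_bil] bilinear_rzero[OF \<omega>_bil])

lemma bracket_tuple: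
  "bracket (p, q, x, r, s) (p', q', x', r', s') =
    ((p * q' - p' * q) * (\<epsilon>2 - \<epsilon>1) + p * \<omega> a0 x' - p' * \<omega> a0 x - q * \<omega> a1 x' + q' * \<omega> a1 x,
     - (p * q' - p' * q) * (\<epsilon>0 + \<epsilon>3) + p * \<omega> a1 x' - p' * \<omega> a1 x + q * \<omega> a0 x' - q' * \<omega> a0 x,
     (p * q' - p' * q) *\<^sub>R z + p *\<^sub>R D0 x' - p' *\<^sub>R D0 x + q *\<^sub>R D1 x' - q' *\<^sub>R D1 x + br x x',
     (p * r' - p' * r) * \<epsilon>0 - (p * s' - p' * s) * \<epsilon>1 + (q * r' - q' * r) * \<epsilon>2
       - (q * s' - q' * s) * \<epsilon>3 + (p * q' - p' * q) * \<epsilon>4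
       + p * \<omega> b0 x' - p' * \<omega> b0 x + q * \<omega> (b1 + z) x' - q' * \<omega> (b1 + z) x
       - r * \<omega> a0 x' + r' * \<omega> a0 x - s * \<omega> a1 x' + s' * \<omega> a1 x + \<phi>0 x x',
     (p * r' - p' * r) * \<epsilon>1 + (p * s' - p' * s) * \<epsilon>0 + (q * r' - q' * r) * \<epsilon>3
       + (q * s' - q' * s) * \<epsilon>2 + (p * q' - p' * q) * \<epsilon>5
       + p * \<omega> b1 x' - p' * \<omega> b1 x + q * \<omega> b2 x' - q' * \<omega> b2 x
       + r * \<omega> a1 x' - r' * \<omega> a1 x - s * \<omega> a0 x' + s' * \<omega> a0 x + \<phi>1 x x')"
  by (simp add: bracket_def ext_bracket_def Let_def ext_basis_defs ext_coord_defs wedge11_def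
      scaleR_left_diff_distrib algebra_simps)

lemmas lin_simps =
  bilinear_lzero[OF br_bil] bilinear_rzero[OF br_bil] bilinear_lzero[OF \<omega>_bil]
  bilinear_rzero[OF \<omega>_bil] bilinear_lneg[OF br_bil] bilinear_rneg[OF br_bil]
  bilinear_lneg[OF \<omega>_bil] bilinear_rneg[OF \<omega>_bil] bilinear_ladd[OF \<omega>_bil] linear_0[OF D(1)] linear_0[OF D(2)]
  linear_neg[OF D(1)] linear_neg[OF D(2)] act_on_form_zero[OF D(1)] act_on_form_zero[OF D(2)] br_self

lemma act_on_form_neg: 
  "act_on_form \<omega> D0 (- x) y = - act_on_form \<omega> D0 x y" "act_on_form \<omega> D0 x (- y) = - act_on_form \<omega> D0 x y"
  "act_on_form \<omega> D1 (- x) y = - act_on_form \<omega> D1 x y" "act_on_form \<omega> D1 x (- y) = - act_on_form \<omega> D1 x y"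
  by (simp_all add: act_on_form_def lin_simps)

lemmas eval_simps = cyclic_sum_def ext_basis_defs bracket_tuple lin_simps act_on_form_neg zero_prod_def

lemma form_bil: "bilinear (ext_form \<omega>)"
  unfolding bilinear_def linear_iff
  by (auto simp: ext_form_def ext_coord_defs wedge11_def bilinear_ladd[OF \<omega>_bil]
      bilinear_radd[OF \<omega>_bil] bilinear_lmul[OF \<omega>_bil] bilinear_rmul[OF \<omega>_bil] algebra_simps)

lemma form_tuple:
  "ext_form \<omega> (p, q, x, r, s) (p', q', x', r', s')
     = \<omega> x x' + (p * r' - p' * r) + (q * s' - q' * s)"
  by (simp add: ext_form_def ext_coord_defs wedge11_def)

text \<open>The coefficient \<open>b\<^sub>1 + z\<close> of \<open>e\<^sub>0\<close> in \<open>[d\<^sub>1, x]\<close> balances the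
  middle component \<open>z\<close> of \<open>[d\<^sub>0, d\<^sub>1]\<close> on \<open>(d\<^sub>0, d\<^sub>1, x)\<close>, and the two-forms \<open>\<phi>0\<close> and \<open>\<phi>1\<close> balance \<open>D0\<close> and
  \<open>D1\<close> on \<open>(d\<^sub>k, x, y)\<close>.\<close>

lemma form_closed: "cyclic_sum (ext_form \<omega>) bracket u v w = 0"
proof (rule alternating_ext_zero[where T = "cyclic_sum (ext_form \<omega>) bracket"])
  show "cyclic_sum (ext_form \<omega>) bracket ext_d0 (ext_in x) (ext_in y) = 0"
    "cyclic_sum (ext_form \<omega>) bracket ext_d1 (ext_in x) (ext_in y) = 0" for x y
    using \<omega>_skew[of x "D0 y"] \<omega>_skew[of x "D1 y"]
    by (simp_all add: eval_simps form_tuple act_on_form_def)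
  show "cyclic_sum (ext_form \<omega>) bracket (ext_in x) (ext_in y) (ext_in w) = 0" for x y w
    using closed[of x y w] by (simp add: eval_simps form_tuple)
  show "cyclic_sum (ext_form \<omega>) bracket v u w = - cyclic_sum (ext_form \<omega>) bracket u v w" for u v w
    by (rule cyclic_sum_swap[OF form_bil bracket_skew])
  show "linear (\<lambda>u. cyclic_sum (ext_form \<omega>) bracket u v w)" for v w
    by (rule cyclic_sum_linear[OF form_bil bracket_bil])
qed (simp_all add: eval_simps form_tuple)

lemma form_nondeg: "(\<And>v. ext_form \<omega> u v = 0) \<Longrightarrow> u = 0"
proof -
  assume *: "\<And>v. ext_form \<omega> u v = 0"
  obtain p q x r s where u: "u = (p, q, x, r, s)" by (cases u) auto
  have "x = 0" using *[of "ext_in _"] by (intro nondeg) (simp add: u form_tuple ext_in_def)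
  then show ?thesis
    using *[of ext_d0] *[of ext_d1] *[of ext_e0] *[of ext_e1]
    by (simp add: u form_tuple ext_basis_defs lin_simps zero_prod_def)
qed

lemma ext_finite_span: "\<exists>B::'a ext set. finite B \<and> span B = UNIV"
proof -
  obtain S :: "'a set" where S: "finite S" "span S = UNIV"
    using symplectic_finite_span[OF symp] by blast
  let ?B = "{ext_d0, ext_d1, ext_e0, ext_e1} \<union> ext_in ` S"
  have lin: "linear (ext_in :: 'a \<Rightarrow> 'a ext)" by (simp add: linear_iff ext_in_def)
  have "ext_in x \<in> span ?B" for x :: 'a
  proof -
    have "ext_in x \<in> ext_in ` span S" using S by auto
    also have "\<dots> = span (ext_in ` S)" by (rule linear_span_image[OF lin, symmetric])
    also have "\<dots> \<subseteq> span ?B" by (rule span_mono) auto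
    finally show ?thesis .
  qed
  then have "u \<in> span ?B" for u :: "'a ext"
    by (subst ext_decompose[of u]) (intro span_add span_scale, auto intro: span_base)
  then show ?thesis using S(1) by (intro exI[of _ ?B]) auto
qed

lemma symplectic_iff_jacobi:
  "symplectic_lie_algebra bracket (ext_form \<omega>) \<longleftrightarrow> (\<forall>u v w. jacobiator u v w = 0)"
proof -
  have "bracket x x = 0" for x
    using bracket_skew[of x x] by (simp add: eq_neg_iff_add_eq_0 flip: scaleR_2)
  moreover have "ext_form \<omega> x y = - ext_form \<omega> y x" for x y
    using \<omega>_skew[of "ext_proj x"] by (simp add: ext_form_def wedge11_def)
  ultimately show ?thesis
    using bracket_bil form_bil form_nondeg form_closed ext_finite_span
    unfolding symplectic_lie_algebra_def lie_algebra_def cyclic_sum_def by blast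
qed

lemma jacobi_iff_on_basis:
  "(\<forall>u v w. jacobiator u v w = 0) \<longleftrightarrow>
    ((\<forall>x y. jacobiator ext_e0 (ext_in x) (ext_in y) = 0) \<and> (\<forall>x y. jacobiator ext_e1 (ext_in x) (ext_in y) = 0)) \<and>
    ((\<forall>x. jacobiator ext_d0 ext_e0 (ext_in x) = 0) \<and> (\<forall>x. jacobiator ext_d0 ext_e1 (ext_in x) = 0)) \<and>
    ((\<forall>x. jacobiator ext_d1 ext_e0 (ext_in x) = 0) \<and> (\<forall>x. jacobiator ext_d1 ext_e1 (ext_in x) = 0)) \<and>
    (jacobiator ext_d0 ext_d1 ext_e0 = 0 \<and> jacobiator ext_d0 ext_d1 ext_e1 = 0) \<and>
    (\<forall>x y w. jacobiator (ext_in x) (ext_in y) (ext_in w) = 0) \<and>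
    (\<forall>x. jacobiator ext_d0 ext_d1 (ext_in x) = 0) \<and>
    (\<forall>x y. jacobiator ext_d0 (ext_in x) (ext_in y) = 0) \<and> (\<forall>x y. jacobiator ext_d1 (ext_in x) (ext_in y) = 0)"
    (is "_ \<longleftrightarrow> ?R")
proof
  assume ?R
  then have h: ?R .
  have "jacobiator u v w = 0" for u v w
  proof (rule alternating_ext_zero[where T = jacobiator])
    show "linear (\<lambda>u. jacobiator u v w)" for v w by (rule cyclic_sum_linear[OF bracket_bil bracket_bil])
    show "jacobiator u v w = jacobiator v w u" for u v w by (rule cyclic_sum_rotate)
    show "jacobiator v u w = - jacobiator u v w" for u v w by (rule cyclic_sum_swap[OF bracket_bil bracket_skew])
    show "jacobiator ext_d0 ext_e0 ext_e1 = 0" "jacobiator ext_d1 ext_e0 ext_e1 = 0"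
      "jacobiator ext_e0 ext_e1 (ext_in x) = 0" for x
      by (simp_all add: eval_simps)
  qed (use h in blast)+
  then show "\<forall>u v w. jacobiator u v w = 0" by blast
qed blast

lemma orth_derived_iff: "a \<in> symp_orth \<omega> (derived_algebra br) \<longleftrightarrow> (\<forall>x y. \<omega> a (br x y) = 0)"
proof
  assume a: "\<forall>x y. \<omega> a (br x y) = 0"
  have "linear (\<omega> a)" using \<omega>_bil by (simp add: bilinear_def)
  then have "\<omega> a v = 0" if "v \<in> span {br x y | x y. True}" for v
    by (rule linear_eq_0_on_span[OF _ _ that]) (use a in blast)
  then show "a \<in> symp_orth \<omega> (derived_algebra br)"
    by (simp add: symp_orth_def derived_algebra_def)
next
  assume "a \<in> symp_orth \<omega> (derived_algebra br)"
  moreover have "br x y \<in> derived_algebra br" for x y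
    unfolding derived_algebra_def by (rule span_base) blast
  ultimately show "\<forall>x y. \<omega> a (br x y) = 0" by (simp add: symp_orth_def)
qed

lemma orth_bracket: "a \<in> symp_orth \<omega> (derived_algebra br) \<Longrightarrow> \<omega> a (br x y) = 0"
  by (simp add: orth_derived_iff)

lemma adjoint_eq_iff:
  assumes "linear F"
  shows "symp_adjoint \<omega> F u = v \<longleftrightarrow> (\<forall>y. \<omega> u (F y) = \<omega> v y)"
proof -
  have "u = v" if "\<And>y. \<omega> u y = \<omega> v y" for u v
    using nondeg[of "u - v"] that by (simp add: bilinear_lsub[OF \<omega>_bil])
  then show ?thesis by (metis symp_adjoint_eq[OF symp assms])
qed

section \<open>The Jacobi identity triple by triple\<close>

text \<open>The terms \<open>[[e\<^sub>i, x], y]\<close> are symmetric in \<open>x\<close> and \<open>y\<close>, the action of \<open>x\<close> on the plane of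
  \<open>e\<^sub>0, e\<^sub>1\<close> being commutative. What remains is \<open>[[x, y], e\<^sub>i]\<close>.\<close>

lemma jacobi_exy_iff:
  "(\<forall>x y. jacobiator ext_e0 (ext_in x) (ext_in y) = 0) \<and> (\<forall>x y. jacobiator ext_e1 (ext_in x) (ext_in y) = 0)
   \<longleftrightarrow> a0 \<in> symp_orth \<omega> (derived_algebra br) \<and> a1 \<in> symp_orth \<omega> (derived_algebra br)"
  by (auto simp: orth_derived_iff eval_simps algebra_simps)

text \<open>The actions of \<open>d\<^sub>0\<close> and \<open>x\<close> on the plane of \<open>e\<^sub>0, e\<^sub>1\<close> commute, so the identity says that
  \<open>[d\<^sub>0, x]\<close> acts as zero on it; its two coordinates are \<open>f\<^sub>0 \<circ> D\<^sub>0\<close> and \<open>f\<^sub>1 \<circ> D\<^sub>0\<close> plus multiples of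
  \<open>f\<^sub>0\<close> and \<open>f\<^sub>1\<close>.\<close>

lemma jacobi_d0ex_iff:
  "(\<forall>x. jacobiator ext_d0 ext_e0 (ext_in x) = 0) \<and> (\<forall>x. jacobiator ext_d0 ext_e1 (ext_in x) = 0)
   \<longleftrightarrow> symp_adjoint \<omega> D0 a0 = - \<epsilon>0 *\<^sub>R a0 - \<epsilon>2 *\<^sub>R a1 \<and> symp_adjoint \<omega> D0 a1 = \<epsilon>1 *\<^sub>R a0 + \<epsilon>3 *\<^sub>R a1"
proof -
  have "jacobiator ext_d0 ext_e0 (ext_in x) = 0 \<longleftrightarrow>
      \<omega> a0 (D0 x) = \<omega> (- \<epsilon>0 *\<^sub>R a0 - \<epsilon>2 *\<^sub>R a1) x \<and> \<omega> a1 (D0 x) = \<omega> (\<epsilon>1 *\<^sub>R a0 + \<epsilon>3 *\<^sub>R a1) x"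
    "jacobiator ext_d0 ext_e1 (ext_in x) = 0 \<longleftrightarrow>
      \<omega> a0 (D0 x) = \<omega> (- \<epsilon>0 *\<^sub>R a0 - \<epsilon>2 *\<^sub>R a1) x \<and> \<omega> a1 (D0 x) = \<omega> (\<epsilon>1 *\<^sub>R a0 + \<epsilon>3 *\<^sub>R a1) x" for x
    by (auto simp: eval_simps bilinear_lmul[OF \<omega>_bil] bilinear_lsub[OF \<omega>_bil] algebra_simps)
  then show ?thesis by (auto simp: adjoint_eq_iff[OF D(1)])
qed

lemma jacobi_d1ex_iff:
  "(\<forall>x. jacobiator ext_d1 ext_e0 (ext_in x) = 0) \<and> (\<forall>x. jacobiator ext_d1 ext_e1 (ext_in x) = 0)
   \<longleftrightarrow> symp_adjoint \<omega> D1 a0 = - \<epsilon>2 *\<^sub>R a0 + \<epsilon>0 *\<^sub>R a1 \<and> symp_adjoint \<omega> D1 a1 = \<epsilon>3 *\<^sub>R a0 - \<epsilon>1 *\<^sub>R a1"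
proof -
  have "jacobiator ext_d1 ext_e0 (ext_in x) = 0 \<longleftrightarrow>
      \<omega> a0 (D1 x) = \<omega> (- \<epsilon>2 *\<^sub>R a0 + \<epsilon>0 *\<^sub>R a1) x \<and> \<omega> a1 (D1 x) = \<omega> (\<epsilon>3 *\<^sub>R a0 - \<epsilon>1 *\<^sub>R a1) x"
    "jacobiator ext_d1 ext_e1 (ext_in x) = 0 \<longleftrightarrow>
      \<omega> a0 (D1 x) = \<omega> (- \<epsilon>2 *\<^sub>R a0 + \<epsilon>0 *\<^sub>R a1) x \<and> \<omega> a1 (D1 x) = \<omega> (\<epsilon>3 *\<^sub>R a0 - \<epsilon>1 *\<^sub>R a1) x" for x
    by (auto simp: eval_simps bilinear_lmul[OF \<omega>_bil] bilinear_lsub[OF \<omega>_bil] algebra_simps)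
  then show ?thesis by (auto simp: adjoint_eq_iff[OF D(2)])
qed

text \<open>As \<open>d\<^sub>0\<close> and \<open>d\<^sub>1\<close> commute on the plane of \<open>e\<^sub>0, e\<^sub>1\<close>, this says that \<open>[d\<^sub>0, d\<^sub>1]\<close> acts as zero on it.\<close>

lemma jacobi_dde_iff:
  "jacobiator ext_d0 ext_d1 ext_e0 = 0 \<and> jacobiator ext_d0 ext_d1 ext_e1 = 0 \<longleftrightarrow>
   \<epsilon>0 * \<epsilon>1 + \<epsilon>2 * \<epsilon>3 = \<omega> a0 z \<and> \<epsilon>1 * (\<epsilon>2 - \<epsilon>1) - \<epsilon>3 * (\<epsilon>0 + \<epsilon>3) = \<omega> a1 z"
  by (auto simp: eval_simps algebra_simps)

text \<open>The component in the given algebra is its own Jacobi identity. The other components are written,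
  here and below, as differences of the two sides of the equations that their vanishing expresses.\<close>

lemma jacobiator_xyw:
  "jacobiator (ext_in x) (ext_in y) (ext_in w) = (0, 0, 0,
     - (ce_diff2 br (\<lambda>x t. interior_prod a0 \<omega> x * t) \<phi>0 x y w
        - - wedge21 \<phi>1 (interior_prod a1 \<omega>) x y w),
     - (ce_diff2 br (\<lambda>x t. interior_prod a0 \<omega> x * t) \<phi>1 x y w
        - wedge21 \<phi>0 (interior_prod a1 \<omega>) x y w))"
proof -
  have sk: "act_on_form \<omega> F x (br y w) = - act_on_form \<omega> F (br y w) x"
    "act_on_form \<omega> F y (br w x) = - act_on_form \<omega> F (br w x) y"
    "act_on_form \<omega> F w (br x y) = - act_on_form \<omega> F (br x y) w" for F
    by (rule act_on_form_skew)+
  show ?thesis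
    using jacobi[of x y w]
    by (simp add: eval_simps ce_diff2_def wedge21_def interior_prod_def sk algebra_simps)
qed

text \<open>The components along \<open>d\<^sub>0\<close> and \<open>d\<^sub>1\<close> reduce to \<open>\<omega> a\<^sub>0 [x, y]\<close> and \<open>\<omega> a\<^sub>1 [x, y]\<close>, the products of
  \<open>f\<^sub>0\<close> and \<open>f\<^sub>1\<close> that occur being symmetric in \<open>x\<close> and \<open>y\<close>.\<close>

lemma jacobiator_d0xy:
  "jacobiator ext_d0 (ext_in x) (ext_in y) = (- \<omega> a0 (br x y), - \<omega> a1 (br x y),
    ce_diff1 br (\<lambda>x v. br x v + interior_prod a0 \<omega> x *\<^sub>R v) D0 x y
      - - form_endo (interior_prod a1 \<omega>) D1 x y,
    (act_on_form \<phi>0 D0 x y - \<epsilon>0 * \<phi>0 x y + \<epsilon>1 * \<phi>1 x y)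
      - (- trivial_diff br (interior_prod b0 \<omega>) x y
        + 2 * wedge11 (interior_prod b0 \<omega>) (interior_prod a0 \<omega>) x y
        + wedge11 (\<lambda>v. 2 * interior_prod b1 \<omega> v + interior_prod z \<omega> v) (interior_prod a1 \<omega>) x y),
    (act_on_form \<phi>1 D0 x y - \<epsilon>0 * \<phi>1 x y - \<epsilon>1 * \<phi>0 x y)
      - (- trivial_diff br (interior_prod b1 \<omega>) x y
        + 2 * wedge11 (interior_prod b1 \<omega>) (interior_prod a0 \<omega>) x y
        + wedge11 (\<lambda>v. interior_prod b2 \<omega> v - interior_prod b0 \<omega> v) (interior_prod a1 \<omega>) x y))"
proof -
  have sk: "br (D0 x) y = - br y (D0 x)" "br (D0 y) x = - br x (D0 y)"
    "act_on_form \<omega> F x (D0 y) = - act_on_form \<omega> F (D0 y) x" for F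
    by (rule br_skew act_on_form_skew)+
  show ?thesis
    by (simp add: eval_simps ce_diff1_def form_endo_def wedge11_def trivial_diff_def
        interior_prod_def act_on_form_def[of "act_on_form _ _"] sk br_skew[of y x]
        act_on_form_skew[of _ y x] algebra_simps)
qed

lemma jacobiator_d1xy:
  "jacobiator ext_d1 (ext_in x) (ext_in y) = (\<omega> a1 (br x y), - \<omega> a0 (br x y),
    ce_diff1 br (\<lambda>x v. br x v + interior_prod a0 \<omega> x *\<^sub>R v) D1 x y
      - form_endo (interior_prod a1 \<omega>) D0 x y,
    (act_on_form \<phi>0 D1 x y - \<epsilon>2 * \<phi>0 x y + \<epsilon>3 * \<phi>1 x y)
      - (- trivial_diff br (\<lambda>v. interior_prod b1 \<omega> v + interior_prod z \<omega> v) x y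
        + 2 * wedge11 (\<lambda>v. interior_prod b1 \<omega> v + interior_prod z \<omega> v) (interior_prod a0 \<omega>) x y
        + wedge11 (\<lambda>v. interior_prod b2 \<omega> v - interior_prod b0 \<omega> v) (interior_prod a1 \<omega>) x y),
    (act_on_form \<phi>1 D1 x y - \<epsilon>2 * \<phi>1 x y - \<epsilon>3 * \<phi>0 x y)
      - (- trivial_diff br (interior_prod b2 \<omega>) x y
        + 2 * wedge11 (interior_prod b2 \<omega>) (interior_prod a0 \<omega>) x y
        + wedge11 (\<lambda>v. - 2 * interior_prod b1 \<omega> v - interior_prod z \<omega> v) (interior_prod a1 \<omega>) x y))"
proof -
  have sk: "br (D1 x) y = - br y (D1 x)" "br (D1 y) x = - br x (D1 y)"
    "act_on_form \<omega> F x (D1 y) = - act_on_form \<omega> F (D1 y) x" for F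
    by (rule br_skew act_on_form_skew)+
  show ?thesis
    by (simp add: eval_simps ce_diff1_def form_endo_def wedge11_def trivial_diff_def
        interior_prod_def act_on_form_def[of "act_on_form _ _"] sk br_skew[of y x]
        act_on_form_skew[of _ y x] algebra_simps)
qed

text \<open>The components along \<open>d\<^sub>0\<close> and \<open>d\<^sub>1\<close> are combinations of \<open>f\<^sub>0\<close>, \<open>f\<^sub>1\<close> and the forms \<open>f\<^sub>i \<circ> D\<^sub>k\<close>, which
  cancel after inserting the hypotheses.\<close>

lemma jacobiator_ddx:
  assumes "symp_adjoint \<omega> D0 a0 = - \<epsilon>0 *\<^sub>R a0 - \<epsilon>2 *\<^sub>R a1" "symp_adjoint \<omega> D0 a1 = \<epsilon>1 *\<^sub>R a0 + \<epsilon>3 *\<^sub>R a1"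
    "symp_adjoint \<omega> D1 a0 = - \<epsilon>2 *\<^sub>R a0 + \<epsilon>0 *\<^sub>R a1" "symp_adjoint \<omega> D1 a1 = \<epsilon>3 *\<^sub>R a0 - \<epsilon>1 *\<^sub>R a1"
  shows "jacobiator ext_d0 ext_d1 (ext_in x) = (0, 0,
    - (((D0 \<circ> D1) x - (D1 \<circ> D0) x + 2 *\<^sub>R (interior_prod a0 \<omega> x *\<^sub>R z))
       - (br z x + (\<epsilon>2 - \<epsilon>1) *\<^sub>R D0 x - (\<epsilon>0 + \<epsilon>3) *\<^sub>R D1 x)),
    (interior_prod (symp_adjoint \<omega> D0 (b1 + z)) \<omega> x - interior_prod (symp_adjoint \<omega> D1 b0) \<omega> x
        + interior_prod z \<phi>0 x)
      - ((\<epsilon>1 - 2 * \<epsilon>2) * interior_prod b0 \<omega> x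
        + (2 * \<epsilon>0 + \<epsilon>3) * (interior_prod b1 \<omega> x + interior_prod z \<omega> x) - \<epsilon>1 * interior_prod b2 \<omega> x
        + \<epsilon>3 * interior_prod b1 \<omega> x + 3 * \<epsilon>4 * interior_prod a0 \<omega> x + \<epsilon>5 * interior_prod a1 \<omega> x),
    (interior_prod (symp_adjoint \<omega> D0 b2) \<omega> x - interior_prod (symp_adjoint \<omega> D1 b1) \<omega> x
        + interior_prod z \<phi>1 x)
      - ((\<epsilon>1 - 2 * \<epsilon>2) * interior_prod b1 \<omega> x + (2 * \<epsilon>0 + \<epsilon>3) * interior_prod b2 \<omega> x
        + \<epsilon>1 * (interior_prod b1 \<omega> x + interior_prod z \<omega> x)
        - \<epsilon>3 * interior_prod b0 \<omega> x - \<epsilon>4 * interior_prod a1 \<omega> x + 3 * \<epsilon>5 * interior_prod a0 \<omega> x))"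
proof -
  have a: "\<omega> a0 (D0 x) = - \<epsilon>0 * \<omega> a0 x - \<epsilon>2 * \<omega> a1 x" "\<omega> a1 (D0 x) = \<epsilon>1 * \<omega> a0 x + \<epsilon>3 * \<omega> a1 x"
    "\<omega> a0 (D1 x) = - \<epsilon>2 * \<omega> a0 x + \<epsilon>0 * \<omega> a1 x" "\<omega> a1 (D1 x) = \<epsilon>3 * \<omega> a0 x - \<epsilon>1 * \<omega> a1 x"
    using assms unfolding adjoint_eq_iff[OF D(1)] adjoint_eq_iff[OF D(2)]
    by (simp_all add: bilinear_lneg[OF \<omega>_bil] bilinear_lmul[OF \<omega>_bil] bilinear_lsub[OF \<omega>_bil]
        bilinear_ladd[OF \<omega>_bil])
  show ?thesis
    \<comment> \<open>The factor 2 must be split off before it is merged into the scalar \<open>2 * \<omega> a0 x\<close>.\<close>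
    unfolding scaleR_2
    by (simp add: eval_simps a interior_prod_def symp_adjoint_eq[OF symp D(1)]
        symp_adjoint_eq[OF symp D(2)] algebra_simps)
qed

end

(* Items 3, 4 and the last equation of item 6 correct misprints of the source (signs of the f1
   terms, and a superfluous summand l2 in the last wedge product); the printed versions are refutable. *)

theorem proposition4p1:
  fixes br :: "'a::real_vector \<Rightarrow> 'a \<Rightarrow> 'a" and \<omega> :: "'a \<Rightarrow> 'a \<Rightarrow> real"
    and a0 a1 b0 b1 b2 z :: 'a
    and D0 D1 :: "'a \<Rightarrow> 'a"
    and \<epsilon>0 \<epsilon>1 \<epsilon>2 \<epsilon>3 \<epsilon>4 \<epsilon>5 :: real
    and f0 f1 l0 l1 l2 \<zeta> :: "'a \<Rightarrow> real"
    and \<phi>0 \<phi>1 :: "'a \<Rightarrow> 'a \<Rightarrow> real"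
    and adj :: "('a \<Rightarrow> 'a) \<Rightarrow> 'a \<Rightarrow> 'a"
    and \<delta>t :: "('a \<Rightarrow> 'a) \<Rightarrow> 'a \<Rightarrow> 'a \<Rightarrow> 'a"
    and \<delta>f0 :: "('a \<Rightarrow> 'a \<Rightarrow> real) \<Rightarrow> 'a \<Rightarrow> 'a \<Rightarrow> 'a \<Rightarrow> real"
    and \<delta> :: "('a \<Rightarrow> real) \<Rightarrow> 'a \<Rightarrow> 'a \<Rightarrow> real"
  assumes "symplectic_lie_algebra br \<omega>"
    and "linear D0" and "linear D1"
  defines "f0 \<equiv> interior_prod a0 \<omega>" and "f1 \<equiv> interior_prod a1 \<omega>"
    and "l0 \<equiv> interior_prod b0 \<omega>" and "l1 \<equiv> interior_prod b1 \<omega>"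
    and "l2 \<equiv> interior_prod b2 \<omega>" and "\<zeta> \<equiv> interior_prod z \<omega>"
    and "\<phi>0 \<equiv> act_on_form \<omega> D0" and "\<phi>1 \<equiv> act_on_form \<omega> D1"
    and "adj \<equiv> symp_adjoint \<omega>"
    and "\<delta>t \<equiv> ce_diff1 br (\<lambda>x v. br x v + f0 x *\<^sub>R v)"
    and "\<delta>f0 \<equiv> ce_diff2 br (\<lambda>x t. f0 x * t)"
    and "\<delta> \<equiv> trivial_diff br"
  shows "symplectic_lie_algebra
           (ext_bracket br \<omega> a0 a1 b0 b1 b2 z D0 D1 \<epsilon>0 \<epsilon>1 \<epsilon>2 \<epsilon>3 \<epsilon>4 \<epsilon>5) (ext_form \<omega>)
    \<longleftrightarrow>
      \<comment> \<open>1\<close>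
      (a0 \<in> symp_orth \<omega> (derived_algebra br) \<and> a1 \<in> symp_orth \<omega> (derived_algebra br) \<and>
       adj D0 a0 = - \<epsilon>0 *\<^sub>R a0 - \<epsilon>2 *\<^sub>R a1 \<and>
       adj D0 a1 = \<epsilon>1 *\<^sub>R a0 + \<epsilon>3 *\<^sub>R a1 \<and>
       adj D1 a0 = - \<epsilon>2 *\<^sub>R a0 + \<epsilon>0 *\<^sub>R a1 \<and>
       adj D1 a1 = \<epsilon>3 *\<^sub>R a0 - \<epsilon>1 *\<^sub>R a1) \<and>
      \<comment> \<open>2\<close>
      (\<epsilon>0 * \<epsilon>1 + \<epsilon>2 * \<epsilon>3 = \<omega> a0 z \<and>
       \<epsilon>1 * (\<epsilon>2 - \<epsilon>1) - \<epsilon>3 * (\<epsilon>0 + \<epsilon>3) = \<omega> a1 z) \<and>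
      \<comment> \<open>3\<close>
      ((\<forall>x y. \<delta>t D0 x y = - form_endo f1 D1 x y) \<and>
       (\<forall>x y. \<delta>t D1 x y = form_endo f1 D0 x y)) \<and>
      \<comment> \<open>4\<close>
      ((\<forall>x y w. \<delta>f0 \<phi>0 x y w = - wedge21 \<phi>1 f1 x y w) \<and>
       (\<forall>x y w. \<delta>f0 \<phi>1 x y w = wedge21 \<phi>0 f1 x y w)) \<and>
      \<comment> \<open>5\<close>
      ((\<forall>x. interior_prod (adj D0 (b1 + z)) \<omega> x - interior_prod (adj D1 b0) \<omega> x
              + interior_prod z \<phi>0 x
            = (\<epsilon>1 - 2 * \<epsilon>2) * l0 x + (2 * \<epsilon>0 + \<epsilon>3) * (l1 x + \<zeta> x) - \<epsilon>1 * l2 x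
              + \<epsilon>3 * l1 x + 3 * \<epsilon>4 * f0 x + \<epsilon>5 * f1 x) \<and>
       (\<forall>x. interior_prod (adj D0 b2) \<omega> x - interior_prod (adj D1 b1) \<omega> x
              + interior_prod z \<phi>1 x
            = (\<epsilon>1 - 2 * \<epsilon>2) * l1 x + (2 * \<epsilon>0 + \<epsilon>3) * l2 x + \<epsilon>1 * (l1 x + \<zeta> x)
              - \<epsilon>3 * l0 x - \<epsilon>4 * f1 x + 3 * \<epsilon>5 * f0 x) \<and>
       (\<forall>x. (D0 \<circ> D1) x - (D1 \<circ> D0) x + 2 *\<^sub>R (f0 x *\<^sub>R z)
            = br z x + (\<epsilon>2 - \<epsilon>1) *\<^sub>R D0 x - (\<epsilon>0 + \<epsilon>3) *\<^sub>R D1 x)) \<and>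
      \<comment> \<open>6\<close>
      ((\<forall>x y. act_on_form \<phi>0 D0 x y - \<epsilon>0 * \<phi>0 x y + \<epsilon>1 * \<phi>1 x y
            = - \<delta> l0 x y + 2 * wedge11 l0 f0 x y + wedge11 (\<lambda>v. 2 * l1 v + \<zeta> v) f1 x y) \<and>
       (\<forall>x y. act_on_form \<phi>1 D0 x y - \<epsilon>0 * \<phi>1 x y - \<epsilon>1 * \<phi>0 x y
            = - \<delta> l1 x y + 2 * wedge11 l1 f0 x y + wedge11 (\<lambda>v. l2 v - l0 v) f1 x y) \<and>
       (\<forall>x y. act_on_form \<phi>0 D1 x y - \<epsilon>2 * \<phi>0 x y + \<epsilon>3 * \<phi>1 x y
            = - \<delta> (\<lambda>v. l1 v + \<zeta> v) x y + 2 * wedge11 (\<lambda>v. l1 v + \<zeta> v) f0 x y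
              + wedge11 (\<lambda>v. l2 v - l0 v) f1 x y) \<and>
       (\<forall>x y. act_on_form \<phi>1 D1 x y - \<epsilon>2 * \<phi>1 x y - \<epsilon>3 * \<phi>0 x y
            = - \<delta> l2 x y + 2 * wedge11 l2 f0 x y
              + wedge11 (\<lambda>v. - 2 * l1 v - \<zeta> v) f1 x y))"
proof -
  interpret symplectic_extension br \<omega> a0 a1 b0 b1 b2 z D0 D1 \<epsilon>0 \<epsilon>1 \<epsilon>2 \<epsilon>3 \<epsilon>4 \<epsilon>5
    by (rule symplectic_extension.intro[OF assms(1-3)])
  show ?thesis
    \<comment> \<open>The coordinates along \<open>d\<^sub>0, d\<^sub>1\<close> vanish only under the first item, so the congruence rule must
      supply that item while rewriting the others.\<close>
    unfolding bracket_def[symmetric] symplectic_iff_jacobi jacobi_iff_on_basis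
      jacobi_exy_iff jacobi_d0ex_iff jacobi_d1ex_iff jacobi_dde_iff
      f0_def f1_def l0_def l1_def l2_def \<zeta>_def \<phi>0_def \<phi>1_def adj_def \<delta>t_def \<delta>f0_def \<delta>_def
    by (simp only: jacobiator_xyw jacobiator_d0xy jacobiator_d1xy jacobiator_ddx orth_bracket
          zero_prod_def prod.inject neg_equal_0_iff_equal right_minus_eq simp_thms cong: conj_cong)
       (simp only: all_conj_distrib, rule iffI; elim conjE; intro conjI; assumption)
qed

end
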